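(* Let $n\ge 2$, let $m\ge 1$ be an integer, and let $H_1,H_2\in B_n$ be half-twists with $H_1^m=H_2^m$. Then $H_1=H_2$.
   Context: $B_n$ is Artin's braid group with generators $\sigma_1,\dots,\sigma_{n-1}$ and relations $\sigma_i\sigma_j=\sigma_j\sigma_i$ for $|i-j|\ge 2$ and $\sigma_i\sigma_{i+1}\sigma_i=\sigma_{i+1}\sigma_i\sigma_{i+1}$. A half-twist is an element of the conjugacy class of $\sigma_1$ in $B_n$, i.e. an element $q^{-1}\sigma_1 q$ with $q\in B_n$. *)

theory Defs
  imports "HOL-Algebra.Group"
begin

text \<open>Artin braid group B_n by generators and relations.
  A letter (i, True) stands for sigma_i, (i, False) for its inverse; admissible
  indices are 1 <= i <= n-1.  B_n is the set of words modulo the congruence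
  generated by free cancellation and the braid relations.\<close>

type_synonym bword = "(nat \<times> bool) list"

definition braid_wf :: "nat \<Rightarrow> bword \<Rightarrow> bool" where
  "braid_wf n w \<longleftrightarrow> (\<forall>(i,b)\<in>set w. 1 \<le> i \<and> i < n)"

inductive braid_eq :: "nat \<Rightarrow> bword \<Rightarrow> bword \<Rightarrow> bool" for n :: nat where
  refl: "braid_eq n w w"
| sym: "braid_eq n x y \<Longrightarrow> braid_eq n y x"
| trans: "braid_eq n x y \<Longrightarrow> braid_eq n y z \<Longrightarrow> braid_eq n x z"
| cong: "braid_eq n x y \<Longrightarrow> braid_eq n (u @ x @ v) (u @ y @ v)"
| cancel: "1 \<le> i \<Longrightarrow> i < n \<Longrightarrow> braid_eq n [(i, b), (i, \<not> b)] []"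
| far_comm: "1 \<le> i \<Longrightarrow> i + 2 \<le> j \<Longrightarrow> j < n \<Longrightarrow>
     braid_eq n [(i, True), (j, True)] [(j, True), (i, True)]"
| braid: "1 \<le> i \<Longrightarrow> i + 1 < n \<Longrightarrow>
     braid_eq n [(i, True), (i+1, True), (i, True)] [(i+1, True), (i, True), (i+1, True)]"

definition braid_class :: "nat \<Rightarrow> bword \<Rightarrow> bword set" where
  "braid_class n w = {v. braid_wf n v \<and> braid_eq n w v}"

definition braid_mult :: "nat \<Rightarrow> bword set \<Rightarrow> bword set \<Rightarrow> bword set" where
  "braid_mult n A B = (\<Union>a\<in>A. \<Union>b\<in>B. braid_class n (a @ b))"

definition braid_group :: "nat \<Rightarrow> bword set monoid" where
  "braid_group n = \<lparr> carrier = braid_class n ` {w. braid_wf n w},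
                     mult = braid_mult n,
                     one = braid_class n [] \<rparr>"

definition braid_sigma :: "nat \<Rightarrow> nat \<Rightarrow> bword set" where
  "braid_sigma n i = braid_class n [(i, True)]"

definition half_twist :: "nat \<Rightarrow> bword set \<Rightarrow> bool" where
  "half_twist n h \<longleftrightarrow> (\<exists>q\<in>carrier (braid_group n).
      h = inv\<^bsub>braid_group n\<^esub> q \<otimes>\<^bsub>braid_group n\<^esub> braid_sigma n 1 \<otimes>\<^bsub>braid_group n\<^esub> q)"

end

theory Submission
  imports Defs
begin

text \<open>The claim says that a braid commuting with \<open>\<sigma>\<^sub>1\<^sup>m\<close> commutes with \<open>\<sigma>\<^sub>1\<close>. Multiplying by a power
  of the central full twist \<open>(\<sigma>\<^sub>1 \<dots> \<sigma>\<^bsub>n-1\<^esub>)\<^sup>n\<close> makes the braid positive, and the positive monoid embeds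
  into the group because it is left cancellative (Garside). It remains to see that
  \<open>u s\<^sup>m = t\<^sup>m u\<close> implies \<open>u s = t u\<close> for a positive braid \<open>u\<close> and generators \<open>s\<close>, \<open>t\<close>, by induction on the
  length of \<open>u\<close>. If the first letter \<open>r\<close> of \<open>u\<close> commutes with \<open>t\<close>, cancel it. Otherwise the right lcm
  of \<open>r\<close> and \<open>t\<^sup>m\<close> is \<open>t\<^sup>m r t = r t r\<^sup>m\<close>, which forces \<open>u = r t v\<close> with \<open>v s\<^sup>m = r\<^sup>m v\<close>; by induction
  \<open>v s = r v\<close>, and then \<open>u s = r t r v = t r t v = t u\<close>.\<close>

section \<open>The positive braid monoid\<close>

definition adjacent :: "nat \<Rightarrow> nat \<Rightarrow> bool" where
  "adjacent i j \<longleftrightarrow> j = Suc i \<or> i = Suc j"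

lemma adjacent_sym: "adjacent i j \<longleftrightarrow> adjacent j i"
  by (auto simp: adjacent_def)

lemma adjacent_irrefl [simp]: "\<not> adjacent i i"
  by (auto simp: adjacent_def)

text \<open>The indices are unbounded; \<open>n\<close> enters only later, through conditions on the
  set of letters. Relations act at the head and \<open>Cons\<close> moves them deeper, so case
  analysis on a step shows at once what happens to the first letter.\<close>

inductive pos_step :: "nat list \<Rightarrow> nat list \<Rightarrow> bool" where
  far: "i \<noteq> j \<Longrightarrow> \<not> adjacent i j \<Longrightarrow> pos_step (i # j # w) (j # i # w)"
| adj: "adjacent i j \<Longrightarrow> pos_step (i # j # i # w) (j # i # j # w)"
| Cons: "pos_step x y \<Longrightarrow> pos_step (a # x) (a # y)"

abbreviation pos_eq :: "nat list \<Rightarrow> nat list \<Rightarrow> bool" where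
  "pos_eq \<equiv> pos_step\<^sup>*\<^sup>*"

lemma pos_step_sym: "pos_step x y \<Longrightarrow> pos_step y x"
  by (induction rule: pos_step.induct) (auto intro: pos_step.intros simp: adjacent_sym)

lemma pos_eq_sym: "pos_eq x y \<Longrightarrow> pos_eq y x"
  using sympD[OF symp_rtranclp[OF sympI[of pos_step, OF pos_step_sym]]] .

lemma pos_step_append_right: "pos_step x y \<Longrightarrow> pos_step (x @ w) (y @ w)"
  by (induction rule: pos_step.induct) (auto intro: pos_step.intros)

lemma pos_step_append_left: "pos_step x y \<Longrightarrow> pos_step (w @ x) (w @ y)"
  by (induction w) (auto intro: pos_step.intros)

lemma pos_eq_append:
  assumes "pos_eq x x'" and "pos_eq y y'"
  shows "pos_eq (x @ y) (x' @ y')"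
proof -
  have "pos_eq (x @ y) (x' @ y)"
    using assms(1)
    by (induction rule: rtranclp_induct) (auto intro: pos_step_append_right rtranclp.rtrancl_into_rtrancl)
  moreover have "pos_eq (x' @ y) (x' @ y')"
    using assms(2)
    by (induction rule: rtranclp_induct) (auto intro: pos_step_append_left rtranclp.rtrancl_into_rtrancl)
  ultimately show ?thesis by simp
qed

lemma pos_step_invariants: "pos_step x y \<Longrightarrow> length x = length y \<and> set x = set y"
  by (induction rule: pos_step.induct) auto

lemma pos_eq_length: "pos_eq x y \<Longrightarrow> length x = length y"
  by (induction rule: rtranclp_induct) (auto dest: pos_step_invariants)

lemma pos_eq_set: "pos_eq x y \<Longrightarrow> set x = set y"
  by (induction rule: rtranclp_induct) (auto dest: pos_step_invariants)

quotient_type pbraid = "nat list" / pos_eq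
  by (intro equivpI reflpI sympI transpI) (auto intro: pos_eq_sym)

instantiation pbraid :: monoid_mult
begin

lift_definition one_pbraid :: pbraid is "[]" .
lift_definition times_pbraid :: "pbraid \<Rightarrow> pbraid \<Rightarrow> pbraid" is append
  by (rule pos_eq_append)

instance by standard (transfer; simp)+

end

lift_definition of_word :: "nat list \<Rightarrow> pbraid" is "\<lambda>w. w" .
lift_definition plength :: "pbraid \<Rightarrow> nat" is length by (rule pos_eq_length)
lift_definition letters :: "pbraid \<Rightarrow> nat set" is set by (rule pos_eq_set)

definition gen :: "nat \<Rightarrow> pbraid" where "gen i = of_word [i]"

lemma of_word_Nil [simp]: "of_word [] = 1"
  by transfer simp

lemma of_word_append: "of_word (x @ y) = of_word x * of_word y"
  by transfer simp

lemma of_word_Cons: "of_word (a # x) = gen a * of_word x"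
  unfolding gen_def using of_word_append[of "[a]" x] by simp

lemma of_word_eq_iff: "of_word x = of_word y \<longleftrightarrow> pos_eq x y"
  by transfer simp

lemma of_word_cases: obtains w where "X = of_word w"
  by (metis Quotient3_abs_rep Quotient3_pbraid of_word.abs_eq)

lemma plength_mult [simp]: "plength (X * Y) = plength X + plength Y"
  by transfer simp

lemma plength_gen [simp]: "plength (gen i) = 1"
  unfolding gen_def by transfer simp

text \<open>The relations preserve the set of letters, so this invariant tells powers of different
  generators apart. It settles the base case of the conjugation theorem.\<close>

lemma letters_power_gen: "m \<ge> 1 \<Longrightarrow> letters (gen i ^ m) = {i}"
proof (induction m rule: dec_induct)
  case base
  show ?case unfolding gen_def by (simp, transfer, simp)
next
  case (step k)
  have "letters (X * Y) = letters X \<union> letters Y" for X Y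
    by transfer simp
  moreover have "letters (gen i) = {i}"
    unfolding gen_def by transfer simp
  ultimately show ?case using step by simp
qed

lemma pbraid_cases [case_names one gen]:
  obtains "X = 1" | a Y where "X = gen a * Y"
  by (metis of_word_Cons of_word_Nil of_word_cases neq_Nil_conv)

lemma gen_far: "i \<noteq> j \<Longrightarrow> \<not> adjacent i j \<Longrightarrow> gen i * gen j = gen j * gen i"
  unfolding gen_def by transfer (auto intro: pos_step.far)

lemma gen_adj: "adjacent i j \<Longrightarrow> gen i * gen j * gen i = gen j * gen i * gen j"
  unfolding gen_def by transfer (auto intro: pos_step.adj)

lemma gen_far_left:
  "i \<noteq> j \<Longrightarrow> \<not> adjacent i j \<Longrightarrow> gen i * (gen j * X) = gen j * (gen i * X)"
  using gen_far[of i j] by (simp flip: mult.assoc)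

lemma gen_adj_left:
  "adjacent i j \<Longrightarrow> gen i * (gen j * (gen i * X)) = gen j * (gen i * (gen j * X))"
  using gen_adj[of i j] by (simp flip: mult.assoc)

section \<open>Garside's reduction lemma\<close>

text \<open>What Garside's lemma predicts when \<open>gen a * X = gen b * Y\<close>: both sides are
  multiples of the least common right multiple of the two generators, which is
  \<open>a b a = b a b\<close> or \<open>a b = b a\<close>, or the generator itself.\<close>

definition reduces :: "nat \<Rightarrow> pbraid \<Rightarrow> nat \<Rightarrow> pbraid \<Rightarrow> bool" where
  "reduces a X b Y \<longleftrightarrow>
     (if a = b then X = Y
      else if adjacent a b then \<exists>Z. X = gen b * (gen a * Z) \<and> Y = gen a * (gen b * Z)
      else \<exists>Z. X = gen b * Z \<and> Y = gen a * Z)"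

lemma reduces_sym: "reduces a X b Y \<Longrightarrow> reduces b Y a X"
  by (auto simp: reduces_def adjacent_sym split: if_splits)

lemma reduces_eqD: "reduces a X a Y \<Longrightarrow> X = Y"
  by (simp add: reduces_def)

lemma reduces_adjE:
  assumes "reduces a X b Y" "adjacent a b"
  obtains Z where "X = gen b * (gen a * Z)" "Y = gen a * (gen b * Z)"
  using assms by (auto simp: reduces_def split: if_splits)

lemma reduces_farE:
  assumes "reduces a X b Y" "a \<noteq> b" "\<not> adjacent a b"
  obtains Z where "X = gen b * Z" "Y = gen a * Z"
  using assms by (auto simp: reduces_def split: if_splits)

lemma reduces_adjI:
  "adjacent a b \<Longrightarrow> X = gen b * (gen a * Z) \<Longrightarrow> Y = gen a * (gen b * Z) \<Longrightarrow> reduces a X b Y"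
  by (auto simp: reduces_def)

lemma reduces_farI:
  "a \<noteq> b \<Longrightarrow> \<not> adjacent a b \<Longrightarrow> X = gen b * Z \<Longrightarrow> Y = gen a * Z \<Longrightarrow> reduces a X b Y"
  by (auto simp: reduces_def)

text \<open>A single step either applies a relation at the head, which is one of the two common
  multiples, or leaves the first letter alone.\<close>

lemma pos_step_reduces:
  assumes "pos_step (a # x) (b # y)"
  shows "reduces a (of_word x) b (of_word y)"
  using assms
proof cases
  case (far w)
  then show ?thesis by (intro reduces_farI[where Z = "of_word w"]) (auto simp: of_word_Cons)
next
  case (adj w)
  then show ?thesis by (intro reduces_adjI[where Z = "of_word w"]) (auto simp: of_word_Cons)
next
  case Cons
  then show ?thesis by (auto simp: reduces_def of_word_eq_iff)
qed

text \<open>The cube condition on three atoms. When both \<open>ac\<close> and \<open>bc\<close> are non-commuting pairs, \<open>ab\<close>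
  commutes, because the Coxeter graph of type A contains no triangle.\<close>

lemma reduces_trans:
  assumes ac: "reduces a X c W" and cb: "reduces c W b Y"
    and IH: "\<And>a U b V. gen a * U = gen b * V \<Longrightarrow> plength U < plength W \<Longrightarrow> reduces a U b V"
  shows "reduces a X b Y"
proof -
  \<comment> \<open>Cancelling a generator is the diagonal case of the reduction lemma, available so
    far only below the length of \<open>W\<close>.\<close>
  have cancel: "U = V" if "gen d * U = gen d * V" "plength U < plength W" for d U V
    using IH[OF that] by (rule reduces_eqD)
  have far_adj: "reduces a X b Y"
    if ac: "reduces a X c W" and cb: "reduces c W b Y"
      and *: "a \<noteq> c" "\<not> adjacent a c" "a \<noteq> b" "adjacent c b" for a b X Y
  proof -
    obtain Z where Z: "X = gen c * Z" "W = gen a * Z"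
      using ac * by (elim reduces_farE)
    obtain Z' where Z': "W = gen b * (gen c * Z')" "Y = gen c * (gen b * Z')"
      using cb * by (elim reduces_adjE)
    \<comment> \<open>\<open>W\<close> starts with both \<open>a\<close> and \<open>b\<close>, and
      its tails are shorter than \<open>W\<close>, so the hypothesis applies to them. All later uses
      of \<open>IH\<close> follow this pattern.\<close>
    have red: "reduces a Z b (gen c * Z')"
      using IH Z Z' by simp
    have ca: "c \<noteq> a" "\<not> adjacent c a" and bc: "adjacent b c"
      using * by (simp_all add: adjacent_sym)
    note far = gen_far_left[OF ca] and cb = gen_adj_left[OF that(6)]
    \<comment> \<open>If \<open>a\<close> is far from \<open>b\<close> as well, it commutes with
      both \<open>b\<close> and \<open>c\<close>. Otherwise \<open>a\<close>, \<open>b\<close>,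
      \<open>c\<close> form a path, and the common multiple is the half twist on four strands, of
      length 6.\<close>
    show ?thesis
    proof (cases "adjacent a b")
      case False
      then obtain T where T: "Z = gen b * T" "gen c * Z' = gen a * T"
        using red * by (elim reduces_farE)
      have "reduces c Z' a T"
        using IH[OF T(2)] Z' by simp
      then obtain S where S: "Z' = gen a * S" "T = gen c * S"
        using ca by (elim reduces_farE)
      show ?thesis
      proof (rule reduces_farI[OF that(5) False, where Z = "gen c * (gen b * S)"])
        show "X = gen b * (gen c * (gen b * S))"
          using Z T S cb by simp
        have "Y = gen c * (gen b * (gen a * S))"
          using Z' S by simp
        also have "\<dots> = gen c * (gen a * (gen b * S))"
          by (simp only: gen_far_left[OF that(5) False])
        also have "\<dots> = gen a * (gen c * (gen b * S))"
          by (simp only: far)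
        finally show "Y = gen a * (gen c * (gen b * S))" .
      qed
    next
      case True
      then obtain T where T: "Z = gen b * (gen a * T)" "gen c * Z' = gen a * (gen b * T)"
        using red * by (elim reduces_adjE)
      have "reduces c Z' a (gen b * T)"
        using IH[OF T(2)] Z' by simp
      then obtain S where S: "Z' = gen a * S" "gen b * T = gen c * S"
        using ca by (elim reduces_farE)
      have "plength T < plength W"
        using Z T by simp
      then have "reduces b T c S"
        using IH[OF S(2)] by simp
      then obtain U where U: "T = gen c * (gen b * U)" "S = gen b * (gen c * U)"
        using bc by (elim reduces_adjE)
      note ab = gen_adj_left[OF True]
      show ?thesis
      proof (rule reduces_adjI[OF True, where Z = "gen c * (gen b * (gen a * U))"])
        have "X = gen c * (gen b * (gen a * (gen c * (gen b * U))))"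
          using Z T U by simp
        also have "\<dots> = gen c * (gen b * (gen c * (gen a * (gen b * U))))"
          by (simp only: far)
        also have "\<dots> = gen b * (gen c * (gen b * (gen a * (gen b * U))))"
          by (simp only: cb)
        also have "\<dots> = gen b * (gen c * (gen a * (gen b * (gen a * U))))"
          by (simp only: ab)
        also have "\<dots> = gen b * (gen a * (gen c * (gen b * (gen a * U))))"
          by (simp only: far)
        finally show "X = gen b * (gen a * (gen c * (gen b * (gen a * U))))" .
        have "Y = gen c * (gen b * (gen a * (gen b * (gen c * U))))"
          using Z' S U by simp
        also have "\<dots> = gen c * (gen a * (gen b * (gen a * (gen c * U))))"
          by (simp only: ab)
        also have "\<dots> = gen a * (gen c * (gen b * (gen c * (gen a * U))))"
          by (simp only: far)
        also have "\<dots> = gen a * (gen b * (gen c * (gen b * (gen a * U))))"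
          by (simp only: cb)
        finally show "Y = gen a * (gen b * (gen c * (gen b * (gen a * U))))" .
      qed
    qed
  qed
  consider "a = c" | "b = c" | "a = b" "a \<noteq> c"
    | "a \<noteq> b" "a \<noteq> c" "b \<noteq> c" "\<not> adjacent a c" "\<not> adjacent c b"
    | "a \<noteq> b" "a \<noteq> c" "\<not> adjacent a c" "adjacent c b"
    | "a \<noteq> b" "b \<noteq> c" "adjacent a c" "\<not> adjacent c b"
    | "a \<noteq> b" "adjacent a c" "adjacent c b"
    by metis
  then show ?thesis
  proof cases
    case 1
    then show ?thesis using ac cb reduces_eqD by metis
  next
    case 2
    then show ?thesis using ac cb reduces_eqD by metis
  next
    case 3
    have "X = Y"
    proof (cases "adjacent a c")
      case True
      then obtain Z where Z: "X = gen c * (gen a * Z)" "W = gen a * (gen c * Z)"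
        using ac by (elim reduces_adjE)
      obtain Z' where Z': "W = gen a * (gen c * Z')" "Y = gen c * (gen a * Z')"
        using cb 3 True by (metis reduces_adjE adjacent_sym)
      have len: "plength Z < plength W"
        using Z by simp
      have "gen c * Z = gen c * Z'"
        using cancel[of a] Z Z' by simp
      then have "Z = Z'"
        using len by (rule cancel)
      then show ?thesis using Z Z' by simp
    next
      case False
      then obtain Z where Z: "X = gen c * Z" "W = gen a * Z"
        using ac 3 by (elim reduces_farE)
      obtain Z' where Z': "W = gen a * Z'" "Y = gen c * Z'"
        using cb 3 False by (metis reduces_farE adjacent_sym)
      have "Z = Z'"
        using cancel[of a] Z Z' by simp
      then show ?thesis using Z Z' by simp
    qed
    then show ?thesis using 3 by (simp add: reduces_def)
  next
    case 4
    obtain Z where Z: "X = gen c * Z" "W = gen a * Z"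
      using ac 4 by (elim reduces_farE)
    obtain Z' where Z': "W = gen b * Z'" "Y = gen c * Z'"
      using cb 4 by (metis reduces_farE)
    have red: "reduces a Z b Z'"
      using IH Z Z' by simp
    have far: "gen c * (gen a * V) = gen a * (gen c * V)" "gen c * (gen b * V) = gen b * (gen c * V)" for V
      using 4 gen_far_left by metis+
    show ?thesis
    proof (cases "adjacent a b")
      case True
      then obtain T where "Z = gen b * (gen a * T)" "Z' = gen a * (gen b * T)"
        using red by (elim reduces_adjE)
      then show ?thesis
        using Z Z' far by (intro reduces_adjI[OF True, where Z = "gen c * T"]) simp_all
    next
      case False
      then obtain T where "Z = gen b * T" "Z' = gen a * T"
        using red 4 by (elim reduces_farE)
      then show ?thesis
        using 4 False Z Z' far by (intro reduces_farI[where Z = "gen c * T"]) simp_all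
    qed
  next
    case 5
    then show ?thesis using far_adj ac cb by blast
  next
    case 6
    then have "reduces b Y a X"
      using far_adj[OF reduces_sym[OF cb] reduces_sym[OF ac]] by (simp add: adjacent_sym)
    then show ?thesis by (rule reduces_sym)
  next
    case 7
    then have ca: "adjacent c a" and bc: "adjacent b c"
      by (simp_all add: adjacent_sym)
    have ab: "\<not> adjacent a b"
      using 7 by (auto simp: adjacent_def)
    obtain Z where Z: "X = gen c * (gen a * Z)" "W = gen a * (gen c * Z)"
      using ac 7 by (elim reduces_adjE)
    obtain Z' where Z': "W = gen b * (gen c * Z')" "Y = gen c * (gen b * Z')"
      using cb 7 by (elim reduces_adjE)
    have "reduces a (gen c * Z) b (gen c * Z')"
      using IH Z Z' by simp
    then obtain T where T: "gen c * Z = gen b * T" "gen c * Z' = gen a * T"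
      using 7 ab by (elim reduces_farE)
    have "reduces c Z b T"
      using IH[OF T(1)] Z by simp
    then obtain S where S: "Z = gen b * (gen c * S)" "T = gen c * (gen b * S)"
      using 7 by (elim reduces_adjE)
    have "reduces c Z' a T"
      using IH[OF T(2)] Z' by simp
    then obtain S' where S': "Z' = gen a * (gen c * S')" "T = gen c * (gen a * S')"
      using ca by (elim reduces_adjE)
    \<comment> \<open>The two expressions for \<open>T\<close> both start with \<open>c\<close>.
      After cancelling it, one more reduction exposes the common tail \<open>V\<close> behind the
      half twist on the path \<open>a\<close>, \<open>c\<close>, \<open>b\<close>.\<close>
    have "gen b * S = gen a * S'"
      using cancel[of c] S S' Z by simp
    then have "reduces b S a S'"
      using IH S Z by simp
    then obtain V where V: "S = gen a * V" "S' = gen b * V"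
      using 7 ab by (metis reduces_farE adjacent_sym)
    note far = gen_far_left[OF 7(1) ab]
      and cb = gen_adj_left[OF 7(3)] and ca = gen_adj_left[OF ca]
    show ?thesis
    proof (rule reduces_farI[OF 7(1) ab, where Z = "gen c * (gen b * (gen a * (gen c * V)))"])
      have "X = gen c * (gen a * (gen b * (gen c * (gen a * V))))"
        using Z S V by simp
      also have "\<dots> = gen c * (gen b * (gen a * (gen c * (gen a * V))))"
        by (simp only: far)
      also have "\<dots> = gen c * (gen b * (gen c * (gen a * (gen c * V))))"
        by (simp only: ca)
      also have "\<dots> = gen b * (gen c * (gen b * (gen a * (gen c * V))))"
        by (simp only: cb)
      finally show "X = gen b * (gen c * (gen b * (gen a * (gen c * V))))" .
      have "Y = gen c * (gen b * (gen a * (gen c * (gen b * V))))"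
        using Z' S' V by simp
      also have "\<dots> = gen c * (gen a * (gen b * (gen c * (gen b * V))))"
        by (simp only: far)
      also have "\<dots> = gen c * (gen a * (gen c * (gen b * (gen c * V))))"
        by (simp only: cb)
      also have "\<dots> = gen a * (gen c * (gen a * (gen b * (gen c * V))))"
        by (simp only: ca)
      also have "\<dots> = gen a * (gen c * (gen b * (gen a * (gen c * V))))"
        by (simp only: far)
      finally show "Y = gen a * (gen c * (gen b * (gen a * (gen c * V))))" .
    qed
  qed
qed

text \<open>Outer induction on length, inner induction on the chain of steps from
  \<open>a # x\<close> to \<open>b # y\<close>. Each new step is composed with the earlier ones by
  \<open>reduces_trans\<close>; all words in the chain have equal length, so the outer hypothesis
  supplies its premise.\<close>

lemma reduction:
  assumes "gen a * X = gen b * Y"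
  shows "reduces a X b Y"
  using assms
proof (induction "plength X" arbitrary: a X b Y rule: less_induct)
  case less
  obtain x y where X: "X = of_word x" and Y: "Y = of_word y"
    using of_word_cases by metis
  have "pos_eq (a # x) (b # y)"
    using less.prems by (simp add: X Y flip: of_word_Cons of_word_eq_iff)
  then show ?case
    unfolding Y
  proof (induction "b # y" arbitrary: b y rule: rtranclp_induct)
    case base
    then show ?case by (simp add: reduces_def X)
  next
    case (step v)
    then obtain c w where v: "v = c # w"
      by (metis pos_step_invariants length_0_conv list.distinct(1) neq_Nil_conv)
    have "length x = length w"
      using step.hyps(1) pos_eq_length v by fastforce
    then have "plength (of_word w) = plength X"
      unfolding X by transfer simp
    then show ?case
      using reduces_trans[OF step.hyps(3)[OF v] pos_step_reduces] step.hyps(2) v less.hyps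
      by metis
  qed
qed

lemma gen_left_cancel: "gen a * X = gen a * Y \<Longrightarrow> X = Y"
  using reduction reduces_eqD by blast

lemma pbraid_left_cancel:
  fixes U X Y :: pbraid
  assumes "U * X = U * Y" shows "X = Y"
  using assms
proof (induction "plength U" arbitrary: U rule: less_induct)
  case less
  show ?case
  proof (cases U rule: pbraid_cases)
    case one
    with less.prems show ?thesis by simp
  next
    case (gen a V)
    with less.prems have "V * X = V * Y"
      by (auto simp: mult.assoc dest: gen_left_cancel)
    with less.hyps[of V] gen show ?thesis by simp
  qed
qed

section \<open>Conjugating powers of generators by positive braids\<close>

text \<open>After one \<open>t\<close> is peeled off, the reduction lemma shows that the remaining
  \<open>gen t ^ k * X\<close> is again left divisible by \<open>r\<close>, so the argument repeats
  until only \<open>X\<close> is left.\<close>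

lemma gen_dvd_power_mult:
  assumes "adjacent r t" and "m \<ge> 1" and "gen r * Y = gen t ^ m * X"
  obtains Z where "X = gen r * (gen t * Z)"
  using assms(2,3)
proof (induction m arbitrary: Y thesis rule: dec_induct)
  case base
  then show ?case using reduction[of r Y t X] assms(1) by (auto elim: reduces_adjE)
next
  case (step k)
  have "gen r * Y = gen t * (gen t ^ k * X)"
    using step.prems by (simp add: mult.assoc)
  then obtain Z where "gen t ^ k * X = gen r * (gen t * Z)"
    using reduction assms(1) by (metis reduces_adjE)
  then show ?case using step.IH step.prems(1) by metis
qed

text \<open>By \<open>t r t = r t r\<close>, each \<open>t\<close> that passes \<open>r t\<close>
  from left to right becomes an \<open>r\<close>.\<close>

lemma gen_adj_power:
  "adjacent r t \<Longrightarrow> gen t ^ m * (gen r * gen t) = gen r * gen t * gen r ^ m"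
proof (induction m)
  case (Suc m)
  then show ?case by (metis gen_adj mult.assoc power_Suc power_Suc2)
qed simp

theorem gen_power_conjugation:
  assumes "m \<ge> 1" and "U * gen s ^ m = gen t ^ m * U"
  shows "U * gen s = gen t * U"
  using assms(2)
\<comment> \<open>\<open>t\<close> must vary, because the adjacent case passes from \<open>t\<close>
  to \<open>r\<close>.\<close>
proof (induction "plength U" arbitrary: U t rule: less_induct)
  case less
  show ?case
  proof (cases U rule: pbraid_cases)
    case one
    then have "letters (gen s ^ m) = letters (gen t ^ m)"
      using less.prems by simp
    then show ?thesis using one assms(1) by (simp add: letters_power_gen)
  next
    case (gen r V)
    show ?thesis
    proof (cases "adjacent r t")
      case False
      then have comm: "gen t * gen r = gen r * gen t"
        using gen_far by metis
      then have "gen t ^ m * gen r = gen r * gen t ^ m"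
        by (rule power_commuting_commutes)
      then have "V * gen s ^ m = gen t ^ m * V"
        using less.prems gen gen_left_cancel by (metis mult.assoc)
      then have "V * gen s = gen t * V"
        using less.hyps gen by simp
      then show ?thesis using comm gen by (metis mult.assoc)
    next
      case True
      have "gen r * (V * gen s ^ m) = gen t ^ m * (gen r * V)"
        using less.prems gen by (simp add: mult.assoc)
      then obtain Z where "gen r * V = gen r * (gen t * Z)"
        using gen_dvd_power_mult True assms(1) by metis
      then have U: "U = gen r * gen t * Z"
        using gen by (simp add: mult.assoc)
      then have "gen r * gen t * (Z * gen s ^ m) = gen r * gen t * (gen r ^ m * Z)"
        using less.prems gen_adj_power[OF True] by (metis mult.assoc)
      then have "Z * gen s ^ m = gen r ^ m * Z"
        by (rule pbraid_left_cancel)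
      then have "Z * gen s = gen r * Z"
        using less.hyps U by simp
      then show ?thesis using U gen_adj[OF True] by (metis mult.assoc)
    qed
  qed
qed

section \<open>The full twist\<close>

lemma of_word_power: "of_word (concat (replicate k w)) = of_word w ^ k"
  by (induction k) (simp_all add: of_word_append)

lemma gen_commute_of_word:
  assumes "\<And>j. j \<in> set w \<Longrightarrow> j \<noteq> i \<and> \<not> adjacent i j"
  shows "gen i * of_word w = of_word w * gen i"
  using assms
proof (induction w)
  case (Cons a w)
  have "gen i * of_word (a # w) = gen a * (gen i * of_word w)"
    using Cons.prems[of a] gen_far_left[of i a] by (auto simp: of_word_Cons)
  also have "\<dots> = of_word (a # w) * gen i"
    using Cons by (simp add: of_word_Cons mult.assoc)
  finally show ?case .
qed simp

definition coxeter_elt :: "nat \<Rightarrow> pbraid" where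
  "coxeter_elt n = of_word [1..<n]"

text \<open>Split \<delta> as \<open>A * gen i * gen (i + 1) * B\<close>: \<open>gen i\<close>
  commutes with \<open>B\<close>, \<open>gen (i + 1)\<close> commutes with \<open>A\<close>, and the
  braid relation acts in between.\<close>

lemma coxeter_elt_shift:
  assumes "1 \<le> i" "i + 1 < n"
  shows "coxeter_elt n * gen i = gen (i + 1) * coxeter_elt n"
proof -
  define A B where "A = of_word [1..<i]" and "B = of_word [i+2..<n]"
  have "[1..<n] = [1..<i] @ i # (i + 1) # [i+2..<n]"
    using assms upt_add_eq_append[of 1 i "n - i"] by (simp add: upt_conv_Cons)
  then have \<delta>: "coxeter_elt n = A * (gen i * (gen (i + 1) * B))"
    by (simp add: coxeter_elt_def A_def B_def of_word_append of_word_Cons)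
  have A: "gen (i + 1) * A = A * gen (i + 1)"
    unfolding A_def by (rule gen_commute_of_word) (auto simp: adjacent_def)
  have B: "gen i * B = B * gen i"
    unfolding B_def by (rule gen_commute_of_word) (auto simp: adjacent_def)
  have "coxeter_elt n * gen i = A * (gen i * (gen (i + 1) * (gen i * B)))"
    by (simp add: \<delta> B mult.assoc)
  also have "\<dots> = A * (gen (i + 1) * (gen i * (gen (i + 1) * B)))"
    using gen_adj_left[of i "i + 1"] by (simp add: adjacent_def)
  also have "\<dots> = gen (i + 1) * coxeter_elt n"
    using A by (simp add: \<delta> flip: mult.assoc)
  finally show ?thesis .
qed

lemma coxeter_elt_shift_word:
  assumes "set w \<subseteq> {1..<n - 1}"
  shows "coxeter_elt n * of_word w = of_word (map Suc w) * coxeter_elt n"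
  using assms
proof (induction w)
  case (Cons a w)
  have a: "1 \<le> a" "a + 1 < n"
    using Cons.prems by auto
  have "coxeter_elt n * of_word (a # w) = coxeter_elt n * gen a * of_word w"
    by (simp add: of_word_Cons mult.assoc)
  also have "\<dots> = gen (Suc a) * (coxeter_elt n * of_word w)"
    using coxeter_elt_shift[OF a] by (simp add: mult.assoc)
  also have "\<dots> = of_word (map Suc (a # w)) * coxeter_elt n"
    using Cons by (simp add: of_word_Cons mult.assoc)
  finally show ?case .
qed simp

lemma coxeter_elt_shift_power:
  assumes "1 \<le> i" "i + k < n"
  shows "coxeter_elt n ^ k * gen i = gen (i + k) * coxeter_elt n ^ k"
  using assms(2)
proof (induction k)
  case (Suc k)
  have "coxeter_elt n ^ Suc k * gen i = coxeter_elt n * gen (i + k) * coxeter_elt n ^ k"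
    using Suc by (simp add: mult.assoc)
  also have "\<dots> = gen (i + Suc k) * coxeter_elt n ^ Suc k"
    using Suc.prems assms(1) coxeter_elt_shift[of "i + k" n] by (simp add: mult.assoc)
  finally show ?case .
qed simp

text \<open>The last generator cannot be shifted further; two factors \<delta> bring it back to the
  first one. With \<open>E\<close> and \<open>F\<close> denoting \<delta> without its first and last
  letter, shifting gives \<open>\<delta> F = E \<delta>\<close>; multiply by \<open>gen 1\<close> on
  the left and \<open>gen (n - 1)\<close> on the right.\<close>

lemma coxeter_elt_wrap:
  assumes "n \<ge> 2"
  shows "coxeter_elt n ^ 2 * gen (n - 1) = gen 1 * coxeter_elt n ^ 2"
proof -
  let ?\<delta> = "coxeter_elt n"
  have "[1..<n] = 1 # [2..<n]"
    using assms by (simp add: upt_conv_Cons numeral_2_eq_2)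
  then have first: "?\<delta> = gen 1 * of_word [2..<n]"
    by (simp add: coxeter_elt_def of_word_Cons)
  have "[1..<n] = [1..<n - 1] @ [n - 1]"
    using assms upt_Suc_append[of 1 "n - 1"] by simp
  then have last: "?\<delta> = of_word [1..<n - 1] * gen (n - 1)"
    by (simp add: coxeter_elt_def of_word_append of_word_Cons)
  have "?\<delta> * of_word [1..<n - 1] = of_word [2..<n] * ?\<delta>"
    using coxeter_elt_shift_word[of "[1..<n - 1]" n] assms
    by (simp add: map_Suc_upt numeral_2_eq_2)
  then have "gen 1 * (?\<delta> * of_word [1..<n - 1]) * gen (n - 1) = ?\<delta> * ?\<delta> * gen (n - 1)"
    using first by (simp add: mult.assoc)
  then show ?thesis
    using last by (simp add: power2_eq_square mult.assoc)
qed

definition full_twist_word :: "nat \<Rightarrow> nat list" where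
  "full_twist_word n = concat (replicate n [1..<n])"

definition full_twist :: "nat \<Rightarrow> pbraid" where
  "full_twist n = of_word (full_twist_word n)"

lemma full_twist_eq: "full_twist n = coxeter_elt n ^ n"
  by (simp add: full_twist_def full_twist_word_def coxeter_elt_def of_word_power)

lemma full_twist_central:
  assumes "1 \<le> i" "i < n"
  shows "full_twist n * gen i = gen i * full_twist n"
proof -
  let ?\<delta> = "coxeter_elt n"
  \<comment> \<open>Read from the right: \<open>n - 1 - i\<close> factors \<delta> raise
    \<open>i\<close> to \<open>n - 1\<close>, two wrap it to 1, and \<open>i - 1\<close> raise it
    back to \<open>i\<close>.\<close>
  have n: "n = (i - 1) + 2 + (n - 1 - i)"
    using assms by simp
  have Z: "full_twist n = ?\<delta> ^ (i - 1) * (?\<delta> ^ 2 * ?\<delta> ^ (n - 1 - i))"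
    unfolding full_twist_eq by (subst n, simp only: power_add mult.assoc)
  have s1: "?\<delta> ^ (n - 1 - i) * gen i = gen (n - 1) * ?\<delta> ^ (n - 1 - i)"
    using coxeter_elt_shift_power[of i "n - 1 - i" n] assms by simp
  have s2: "?\<delta> ^ 2 * gen (n - 1) = gen 1 * ?\<delta> ^ 2"
    using coxeter_elt_wrap assms by simp
  have s3: "?\<delta> ^ (i - 1) * gen 1 = gen i * ?\<delta> ^ (i - 1)"
    using coxeter_elt_shift_power[of 1 "i - 1" n] assms by simp
  have "full_twist n * gen i = ?\<delta> ^ (i - 1) * (?\<delta> ^ 2 * (?\<delta> ^ (n - 1 - i) * gen i))"
    by (simp only: Z mult.assoc)
  also have "\<dots> = ?\<delta> ^ (i - 1) * ((?\<delta> ^ 2 * gen (n - 1)) * ?\<delta> ^ (n - 1 - i))"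
    by (simp only: s1 mult.assoc)
  also have "\<dots> = (?\<delta> ^ (i - 1) * gen 1) * (?\<delta> ^ 2 * ?\<delta> ^ (n - 1 - i))"
    by (simp only: s2 mult.assoc)
  also have "\<dots> = gen i * full_twist n"
    by (simp only: s3 Z mult.assoc)
  finally show ?thesis .
qed

text \<open>The full twist with \<open>gen i\<close> divided out: one of the \<open>n\<close> blocks
  \<delta> lacks its letter 1. A \<open>gen i\<close> in front passes the first \<open>i - 1\<close>
  blocks, arrives as \<open>gen 1\<close> and completes that block.\<close>

definition cofactor :: "nat \<Rightarrow> nat \<Rightarrow> nat list" where
  "cofactor n i = concat (replicate (i - 1) [1..<n]) @ [2..<n] @ concat (replicate (n - i) [1..<n])"

lemma gen_cofactor:
  assumes "1 \<le> i" "i < n"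
  shows "gen i * of_word (cofactor n i) = full_twist n"
proof -
  let ?\<delta> = "coxeter_elt n"
  have s: "gen i * ?\<delta> ^ (i - 1) = ?\<delta> ^ (i - 1) * gen 1"
    using coxeter_elt_shift_power[of 1 "i - 1" n] assms by simp
  have "[1..<n] = 1 # [2..<n]"
    using assms by (simp add: upt_conv_Cons numeral_2_eq_2)
  then have first: "?\<delta> = gen 1 * of_word [2..<n]"
    by (simp add: coxeter_elt_def of_word_Cons)
  have "gen i * of_word (cofactor n i) = (gen i * ?\<delta> ^ (i - 1)) * (of_word [2..<n] * ?\<delta> ^ (n - i))"
    by (simp add: cofactor_def of_word_append of_word_power coxeter_elt_def mult.assoc)
  also have "\<dots> = ?\<delta> ^ (i - 1) * (?\<delta> * ?\<delta> ^ (n - i))"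
    by (subst (3) first) (simp only: s mult.assoc)
  also have "\<dots> = ?\<delta> ^ ((i - 1) + Suc (n - i))"
    by (simp only: power_add power_Suc)
  also have "\<dots> = full_twist n"
    using assms by (simp add: full_twist_eq)
  finally show ?thesis .
qed

text \<open>The left factorization together with centrality gives this one after cancelling
  \<open>gen i\<close>.\<close>

lemma cofactor_gen:
  assumes "1 \<le> i" "i < n"
  shows "of_word (cofactor n i) * gen i = full_twist n"
proof (rule gen_left_cancel[of i])
  show "gen i * (of_word (cofactor n i) * gen i) = gen i * full_twist n"
    using gen_cofactor[OF assms] full_twist_central[OF assms] by (simp flip: mult.assoc)
qed

lemma set_full_twist_word: "set (full_twist_word n) \<subseteq> {1..<n}"
  by (auto simp: full_twist_word_def)

lemma set_cofactor: "set (cofactor n i) \<subseteq> {1..<n}"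
  by (auto simp: cofactor_def)

section \<open>Embedding of the positive monoid into the braid group\<close>

text \<open>A braid word \<open>w\<close> represents the fraction with numerator \<open>numerator n w\<close> and denominator
  the full twist to the power \<open>neg_count w\<close>: each inverse letter \<open>(i, False)\<close> is replaced by the
  cofactor of \<open>i\<close> in the full twist.\<close>

definition numerator :: "nat \<Rightarrow> bword \<Rightarrow> nat list" where
  "numerator n w = concat (map (\<lambda>(i, b). if b then [i] else cofactor n i) w)"

definition neg_count :: "bword \<Rightarrow> nat" where
  "neg_count w = length (filter (\<lambda>(i, b). \<not> b) w)"

definition pos_word :: "nat list \<Rightarrow> bword" where
  "pos_word p = map (\<lambda>i. (i, True)) p"

lemma numerator_append: "numerator n (x @ y) = numerator n x @ numerator n y"
  by (simp add: numerator_def)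

lemma neg_count_append: "neg_count (x @ y) = neg_count x + neg_count y"
  by (simp add: neg_count_def)

lemma numerator_pos_word [simp]: "numerator n (pos_word p) = p"
  by (induction p) (simp_all add: numerator_def pos_word_def)

lemma neg_count_pos_word [simp]: "neg_count (pos_word p) = 0"
  by (simp add: neg_count_def pos_word_def)

lemma braid_wf_append [simp]: "braid_wf n (x @ y) \<longleftrightarrow> braid_wf n x \<and> braid_wf n y"
  by (auto simp: braid_wf_def)

lemma braid_wf_Cons [simp]: "braid_wf n ((i, b) # w) \<longleftrightarrow> 1 \<le> i \<and> i < n \<and> braid_wf n w"
  by (auto simp: braid_wf_def)

lemma braid_wf_Nil [simp]: "braid_wf n []"
  by (simp add: braid_wf_def)

lemma braid_wf_pos_word [simp]: "braid_wf n (pos_word p) \<longleftrightarrow> set p \<subseteq> {1..<n}"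
  by (auto simp: braid_wf_def pos_word_def)

lemma set_numerator: "braid_wf n w \<Longrightarrow> set (numerator n w) \<subseteq> {1..<n}"
proof (induction w)
  case (Cons a w)
  obtain i b where a: "a = (i, b)" by force
  have "numerator n (a # w) = (if b then [i] else cofactor n i) @ numerator n w"
    by (simp add: numerator_def a)
  then show ?case
    using Cons a set_cofactor[of n i] by (cases b) simp_all
qed (simp add: numerator_def)

lemma braid_eq_wf: "braid_eq n x y \<Longrightarrow> braid_wf n x \<longleftrightarrow> braid_wf n y"
  by (induction rule: braid_eq.induct) auto

lemma full_twist_power_commute:
  assumes "set p \<subseteq> {1..<n}"
  shows "full_twist n ^ k * of_word p = of_word p * full_twist n ^ k"
proof -
  have "full_twist n * of_word p = of_word p * full_twist n"
    using assms
  proof (induction p)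
    case (Cons a p)
    have "full_twist n * of_word (a # p) = full_twist n * gen a * of_word p"
      by (simp add: of_word_Cons mult.assoc)
    also have "\<dots> = gen a * (full_twist n * of_word p)"
      using Cons.prems full_twist_central[of a n] by (simp add: mult.assoc)
    also have "\<dots> = of_word (a # p) * full_twist n"
      using Cons by (simp add: of_word_Cons mult.assoc)
    finally show ?case .
  qed simp
  then show ?thesis by (rule power_commuting_commutes)
qed

text \<open>Equality of the two fractions, cross-multiplied. Transitivity rests on left
  cancellation, congruence on centrality of the full twist; \<open>braid_wf\<close> is carried along
  because centrality is proved for letters in \<open>{1..<n}\<close>.\<close>

lemma braid_eq_numerator:
  assumes "braid_eq n x y" and "braid_wf n x"
  shows "full_twist n ^ neg_count y * of_word (numerator n x)
       = full_twist n ^ neg_count x * of_word (numerator n y)"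
  using assms
proof (induction rule: braid_eq.induct)
  case (sym x y)
  then show ?case using braid_eq_wf by metis
next
  case (trans x y z)
  let ?Z = "full_twist n" and ?p = "\<lambda>w. of_word (numerator n w)"
  have xy: "?Z ^ neg_count y * ?p x = ?Z ^ neg_count x * ?p y"
    and yz: "?Z ^ neg_count z * ?p y = ?Z ^ neg_count y * ?p z"
    using trans braid_eq_wf by blast+
  have "?Z ^ neg_count y * (?Z ^ neg_count z * ?p x) = ?Z ^ neg_count z * (?Z ^ neg_count y * ?p x)"
    by (simp add: add.commute flip: mult.assoc power_add)
  also have "\<dots> = ?Z ^ neg_count x * (?Z ^ neg_count z * ?p y)"
    unfolding xy by (simp add: add.commute flip: mult.assoc power_add)
  also have "\<dots> = ?Z ^ neg_count y * (?Z ^ neg_count x * ?p z)"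
    unfolding yz by (simp add: add.commute flip: mult.assoc power_add)
  finally show ?case by (rule pbraid_left_cancel)
next
  case (cong x y u v)
  let ?Z = "full_twist n" and ?p = "\<lambda>w. of_word (numerator n w)"
  have u: "set (numerator n u) \<subseteq> {1..<n}"
    using cong.prems set_numerator by simp
  \<comment> \<open>The powers contributed by \<open>a\<close> move past the numerator of
    \<open>u\<close> to stand beside that of \<open>b\<close>, where the hypothesis applies.
    Separate \<open>a\<close> and \<open>b\<close> let one equation serve both sides.\<close>
  have pull_out: "?Z ^ neg_count (u @ a @ v) * ?p (u @ b @ v)
      = ?Z ^ (neg_count u + neg_count v) * (?p u * ((?Z ^ neg_count a * ?p b) * ?p v))" for a b
  proof -
    have "?Z ^ neg_count (u @ a @ v) * ?p (u @ b @ v)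
        = ?Z ^ (neg_count u + neg_count v) * ((?Z ^ neg_count a * ?p u) * (?p b * ?p v))"
      by (simp add: neg_count_append numerator_append of_word_append add_ac flip: mult.assoc power_add)
    then show ?thesis
      unfolding full_twist_power_commute[OF u] by (simp only: mult.assoc)
  qed
  show ?case
    unfolding pull_out using cong by simp
next
  \<comment> \<open>Exactly one of the two letters is inverse, so the claim is a factorization of
    the full twist, with the cofactor on the right or on the left according to
    \<open>b\<close>.\<close>
  case (cancel i b)
  then show ?case
    using gen_cofactor[of i n] cofactor_gen[of i n]
    by (cases b) (simp_all add: numerator_def neg_count_def of_word_append of_word_Cons)
next
  case (far_comm i j)
  then show ?case
    using gen_far[of i j]
    by (simp add: numerator_def neg_count_def of_word_Cons adjacent_def)
next
  case (braid i)
  then show ?case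
    using gen_adj[of i "i + 1"]
    by (simp add: numerator_def neg_count_def of_word_Cons adjacent_def mult.assoc)
qed simp

text \<open>Positive words have denominator 1, so comparing fractions compares the words
  themselves.\<close>

theorem pos_word_embedding:
  assumes "set p \<subseteq> {1..<n}" and "braid_eq n (pos_word p) (pos_word q)"
  shows "of_word p = of_word q"
  using braid_eq_numerator[OF assms(2)] assms(1) by simp

lemma braid_eq_append:
  assumes "braid_eq n x x'" and "braid_eq n y y'"
  shows "braid_eq n (x @ y) (x' @ y')"
  using braid_eq.cong[OF assms(1), of "[]" y] braid_eq.cong[OF assms(2), of x' "[]"]
  by (auto intro: braid_eq.trans)

text \<open>The bound on the letters of \<open>x\<close> supplies the index ranges demanded by
  \<open>braid_eq\<close>. Its relations are stated with the smaller index first, so the opposite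
  order uses symmetry.\<close>

lemma pos_step_braid_eq:
  assumes "pos_step x y" and "set x \<subseteq> {1..<n}"
  shows "braid_eq n (pos_word x) (pos_word y)"
  using assms
proof (induction rule: pos_step.induct)
  case (far i j w)
  have "braid_eq n [(i, True), (j, True)] [(j, True), (i, True)]"
  proof (cases "i < j")
    case True
    then show ?thesis using far by (intro braid_eq.far_comm) (auto simp: adjacent_def)
  next
    case False
    then show ?thesis
      using far by (intro braid_eq.sym[OF braid_eq.far_comm]) (auto simp: adjacent_def)
  qed
  from braid_eq.cong[OF this, of "[]" "pos_word w"] show ?case
    by (simp add: pos_word_def)
next
  case (adj i j w)
  have "braid_eq n [(i, True), (j, True), (i, True)] [(j, True), (i, True), (j, True)]"
  proof (cases "i < j")
    case True
    then have "j = i + 1" using adj by (auto simp: adjacent_def)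
    then show ?thesis using adj braid_eq.braid[of i n] by auto
  next
    case False
    then have "i = j + 1" using adj by (auto simp: adjacent_def)
    then show ?thesis using adj braid_eq.sym[OF braid_eq.braid[of j n]] by auto
  qed
  from braid_eq.cong[OF this, of "[]" "pos_word w"] show ?case
    by (simp add: pos_word_def)
next
  case (Cons x y a)
  then show ?case
    using braid_eq.cong[of n "pos_word x" "pos_word y" "[(a, True)]" "[]"] by (simp add: pos_word_def)
qed

lemma of_word_eq_braid_eq:
  assumes "of_word x = of_word y" and "set x \<subseteq> {1..<n}"
  shows "braid_eq n (pos_word x) (pos_word y)"
proof -
  have "pos_eq x y"
    using assms(1) by (simp add: of_word_eq_iff)
  then show ?thesis
    using assms(2)
  proof (induction rule: rtranclp_induct)
    case base
    show ?case by (rule braid_eq.refl)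
  next
    case (step y z)
    have "set y \<subseteq> {1..<n}"
      using pos_eq_set[OF step.hyps(1)] step.prems by simp
    with step show ?case
      by (blast intro: braid_eq.trans pos_step_braid_eq)
  qed
qed

section \<open>The braid group\<close>

text \<open>Well-formedness puts \<open>y\<close> into its own class, so equal classes make
  \<open>y\<close> a member of the class of \<open>x\<close>.\<close>

lemma braid_class_eq_iff:
  assumes "braid_wf n y"
  shows "braid_class n x = braid_class n y \<longleftrightarrow> braid_eq n x y"
  using assms braid_eq.refl braid_eq.sym braid_eq.trans
  unfolding braid_class_def by blast

text \<open>All products of representatives have the same class, so the union defining
  \<open>braid_mult\<close> collapses; the factors are nonempty because they contain
  \<open>x\<close> and \<open>y\<close>.\<close>

lemma braid_class_mult:
  assumes "braid_wf n x" "braid_wf n y"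
  shows "braid_class n x \<otimes>\<^bsub>braid_group n\<^esub> braid_class n y = braid_class n (x @ y)"
proof -
  have eq: "braid_class n (a @ b) = braid_class n (x @ y)"
    if "a \<in> braid_class n x" "b \<in> braid_class n y" for a b
  proof -
    have "braid_eq n a x" "braid_eq n b y"
      using that by (auto simp: braid_class_def intro: braid_eq.sym)
    then show ?thesis
      using assms by (simp add: braid_class_eq_iff braid_eq_append)
  qed
  have "braid_class n x \<noteq> {}" "braid_class n y \<noteq> {}"
    using assms braid_eq.refl by (auto simp: braid_class_def)
  then have "(\<Union>a\<in>braid_class n x. \<Union>b\<in>braid_class n y. braid_class n (x @ y)) = braid_class n (x @ y)"
    by simp
  moreover have "(\<Union>a\<in>braid_class n x. \<Union>b\<in>braid_class n y. braid_class n (a @ b))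
      = (\<Union>a\<in>braid_class n x. \<Union>b\<in>braid_class n y. braid_class n (x @ y))"
    by (intro SUP_cong HOL.refl eq)
  ultimately show ?thesis
    by (simp add: braid_group_def braid_mult_def)
qed

lemma braid_class_carrier [simp, intro]:
  "braid_wf n w \<Longrightarrow> braid_class n w \<in> carrier (braid_group n)"
  by (simp add: braid_group_def)

lemma braid_carrierE:
  assumes "g \<in> carrier (braid_group n)"
  obtains w where "braid_wf n w" "g = braid_class n w"
  using assms by (auto simp: braid_group_def)

lemma braid_left_inverse:
  assumes "braid_wf n w"
  shows "\<exists>v. braid_wf n v \<and> braid_eq n (v @ w) []"
  using assms
proof (induction w)
  case (Cons a w)
  obtain i b where a: "a = (i, b)" by force
  obtain v where v: "braid_wf n v" "braid_eq n (v @ w) []"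
    using Cons a by auto
  have "braid_eq n [(i, \<not> b), (i, b)] []"
    using Cons.prems a braid_eq.cancel[of i n "\<not> b"] by simp
  from braid_eq.cong[OF this, of v w] have "braid_eq n ((v @ [(i, \<not> b)]) @ a # w) []"
    using v(2) a by (auto intro: braid_eq.trans)
  then show ?case using v(1) Cons.prems a by (intro exI[of _ "v @ [(i, \<not> b)]"]) auto
qed (auto intro: exI[of _ "[]"] braid_eq.refl)

lemma braid_group_one: "\<one>\<^bsub>braid_group n\<^esub> = braid_class n []"
  by (simp add: braid_group_def)

lemma group_braid_group: "group (braid_group n)"
proof (rule groupI)
  fix x y z
  assume "x \<in> carrier (braid_group n)" "y \<in> carrier (braid_group n)" "z \<in> carrier (braid_group n)"
  then show "x \<otimes>\<^bsub>braid_group n\<^esub> y \<otimes>\<^bsub>braid_group n\<^esub> z = x \<otimes>\<^bsub>braid_group n\<^esub> (y \<otimes>\<^bsub>braid_group n\<^esub> z)"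
    by (auto elim!: braid_carrierE simp: braid_class_mult)
next
  fix x assume "x \<in> carrier (braid_group n)"
  then obtain w where w: "braid_wf n w" "x = braid_class n w" by (rule braid_carrierE)
  then obtain v where v: "braid_wf n v" "braid_eq n (v @ w) []"
    using braid_left_inverse by blast
  then have "braid_class n v \<otimes>\<^bsub>braid_group n\<^esub> x = \<one>\<^bsub>braid_group n\<^esub>"
    using w by (simp add: braid_class_mult braid_group_one braid_class_eq_iff)
  then show "\<exists>y\<in>carrier (braid_group n). y \<otimes>\<^bsub>braid_group n\<^esub> x = \<one>\<^bsub>braid_group n\<^esub>"
    using v(1) by blast
qed (auto elim!: braid_carrierE simp: braid_class_mult braid_group_one)

section \<open>Positive braids inside the group and clearing of denominators\<close>

lemma pos_word_append: "pos_word (p @ q) = pos_word p @ pos_word q"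
  by (simp add: pos_word_def)

lemma pos_class_mult:
  assumes "set p \<subseteq> {1..<n}" "set q \<subseteq> {1..<n}"
  shows "braid_class n (pos_word p) \<otimes>\<^bsub>braid_group n\<^esub> braid_class n (pos_word q)
       = braid_class n (pos_word (p @ q))"
  using assms by (simp add: braid_class_mult pos_word_append)

lemma pos_class_eq_iff:
  assumes "set p \<subseteq> {1..<n}" "set q \<subseteq> {1..<n}"
  shows "braid_class n (pos_word p) = braid_class n (pos_word q) \<longleftrightarrow> of_word p = of_word q"
proof -
  have "braid_class n (pos_word p) = braid_class n (pos_word q) \<longleftrightarrow> braid_eq n (pos_word p) (pos_word q)"
    using assms(2) by (intro braid_class_eq_iff) simp
  then show ?thesis
    using pos_word_embedding[OF assms(1)] of_word_eq_braid_eq[OF _ assms(1)] by blast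
qed

text \<open>\<open>z\<close> collects one full twist for every inverse letter of \<open>w\<close>;
  of this only its centrality among positive braids is recorded.\<close>

lemma positive_multiple:
  assumes "braid_wf n w"
  shows "\<exists>z p. set z \<subseteq> {1..<n} \<and> set p \<subseteq> {1..<n} \<and>
    (\<forall>q. set q \<subseteq> {1..<n} \<longrightarrow> of_word (z @ q) = of_word (q @ z)) \<and>
    braid_eq n (pos_word z @ w) (pos_word p)"
  using assms
proof (induction w)
  case Nil
  show ?case
    by (intro exI[of _ "[]"]) (auto simp: pos_word_def braid_eq.refl)
next
  case (Cons a w)
  obtain i b where a: "a = (i, b)" by force
  have i: "1 \<le> i" "i < n" using Cons.prems a by auto
  obtain z p where z: "set z \<subseteq> {1..<n}" and p: "set p \<subseteq> {1..<n}"
    and central: "\<And>q. set q \<subseteq> {1..<n} \<Longrightarrow> of_word (z @ q) = of_word (q @ z)"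
    and zw: "braid_eq n (pos_word z @ w) (pos_word p)"
    using Cons a by auto
  \<comment> \<open>Centrality lets a positive prefix \<open>q\<close> move in front of
    \<open>z\<close>, after which \<open>z\<close> and \<open>w\<close> combine to
    \<open>p\<close>.\<close>
  have swap: "braid_eq n (pos_word (z @ q) @ w) (pos_word (q @ p))" if "set q \<subseteq> {1..<n}" for q
  proof -
    have "braid_eq n (pos_word (z @ q) @ w) (pos_word (q @ z) @ w)"
      using of_word_eq_braid_eq[OF central[OF that]] that z by (simp add: braid_eq_append braid_eq.refl)
    moreover have "braid_eq n (pos_word (q @ z) @ w) (pos_word (q @ p))"
      using braid_eq.cong[OF zw, of "pos_word q" "[]"] by (simp add: pos_word_append)
    ultimately show ?thesis by (rule braid_eq.trans)
  qed
  show ?case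
  proof (cases b)
    case True
    then have "braid_eq n (pos_word z @ a # w) (pos_word (i # p))"
      using swap[of "[i]"] a i by (simp add: pos_word_def)
    moreover have "set (i # p) \<subseteq> {1..<n}"
      using p i by simp
    ultimately show ?thesis
      using z central by blast
  next
    case False
    let ?f = "full_twist_word n" and ?c = "cofactor n i"
    \<comment> \<open>The new full twist absorbs the inverse letter: it ends in \<open>i\<close>
      after the cofactor, and this \<open>i\<close> cancels against \<open>a\<close>.\<close>
    have "braid_eq n (pos_word ?f) (pos_word (?c @ [i]))"
      using cofactor_gen[OF i] set_full_twist_word
      by (intro of_word_eq_braid_eq) (simp_all add: full_twist_def of_word_append of_word_Cons)
    from braid_eq_append[OF this braid_eq.refl, of "[a]"]
    have "braid_eq n (pos_word ?f @ [a]) (pos_word ?c @ [(i, True), (i, False)])"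
      using a False by (simp add: pos_word_def)
    moreover have "braid_eq n (pos_word ?c @ [(i, True), (i, False)]) (pos_word ?c)"
      using braid_eq.cong[OF braid_eq.cancel[OF i, of True], of "pos_word ?c" "[]"] by simp
    ultimately have "braid_eq n (pos_word ?f @ [a]) (pos_word ?c)"
      by (rule braid_eq.trans)
    from braid_eq.cong[OF this, of "pos_word z" w]
    have "braid_eq n (pos_word (z @ ?f) @ a # w) (pos_word (z @ ?c) @ w)"
      by (simp add: pos_word_append)
    then have eq: "braid_eq n (pos_word (z @ ?f) @ a # w) (pos_word (?c @ p))"
      using swap[OF set_cofactor] by (rule braid_eq.trans)
    have central': "of_word ((z @ ?f) @ q) = of_word (q @ z @ ?f)" if "set q \<subseteq> {1..<n}" for q
    proof -
      have "of_word ((z @ ?f) @ q) = of_word z * (of_word q * of_word ?f)"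
        using full_twist_power_commute[OF that, of 1]
        by (simp add: full_twist_def of_word_append mult.assoc)
      also have "\<dots> = of_word (q @ z @ ?f)"
        using central[OF that] by (simp add: of_word_append flip: mult.assoc)
      finally show ?thesis .
    qed
    have "set (z @ ?f) \<subseteq> {1..<n}" "set (?c @ p) \<subseteq> {1..<n}"
      using z p set_full_twist_word set_cofactor by simp_all
    then show ?thesis
      using eq central' by (intro exI[of _ "z @ ?f"] exI[of _ "?c @ p"] conjI allI impI)
  qed
qed

section \<open>Centralizers of powers and uniqueness of roots\<close>

lemma (in group) conj_pow:
  assumes "q \<in> carrier G" "s \<in> carrier G"
  shows "(inv q \<otimes> s \<otimes> q) [^] (m::nat) = inv q \<otimes> s [^] m \<otimes> q"
proof (induction m)
  case 0
  then show ?case using assms by simp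
next
  case (Suc m)
  have "inv q \<otimes> s [^] m \<otimes> q \<otimes> (inv q \<otimes> s \<otimes> q) = inv q \<otimes> s [^] m \<otimes> (q \<otimes> inv q) \<otimes> s \<otimes> q"
    using assms by (simp only: m_assoc m_closed inv_closed nat_pow_closed)
  then show ?case using Suc assms by (simp add: m_assoc)
qed

text \<open>Multiplying by the central \<open>z\<close> turns \<open>x\<close> into a positive braid
  \<open>p\<close> without changing what it commutes with. The question then lives in the positive
  monoid, where \<open>gen_power_conjugation\<close> applies with both generators equal to
  \<open>gen 1\<close>.\<close>

theorem sigma_power_centralizer:
  fixes m :: nat
  assumes n: "n \<ge> 2" and m: "m \<ge> 1" and x: "x \<in> carrier (braid_group n)"
    and comm: "x \<otimes>\<^bsub>braid_group n\<^esub> braid_sigma n 1 [^]\<^bsub>braid_group n\<^esub> m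
             = braid_sigma n 1 [^]\<^bsub>braid_group n\<^esub> m \<otimes>\<^bsub>braid_group n\<^esub> x"
  shows "x \<otimes>\<^bsub>braid_group n\<^esub> braid_sigma n 1 = braid_sigma n 1 \<otimes>\<^bsub>braid_group n\<^esub> x"
proof -
  interpret group "braid_group n" by (rule group_braid_group)
  let ?c = "\<lambda>p. braid_class n (pos_word p)" and ?G = "braid_group n"
  obtain w where w: "braid_wf n w" "x = braid_class n w"
    using x by (rule braid_carrierE)
  obtain z p where z: "set z \<subseteq> {1..<n}" and p: "set p \<subseteq> {1..<n}"
    and central: "\<And>q. set q \<subseteq> {1..<n} \<Longrightarrow> of_word (z @ q) = of_word (q @ z)"
    and zw: "braid_eq n (pos_word z @ w) (pos_word p)"
    using positive_multiple[OF w(1)] by blast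
  have zx: "?c z \<otimes>\<^bsub>?G\<^esub> x = ?c p"
    using w z p zw by (simp add: braid_class_mult braid_class_eq_iff)
  have zc: "?c z \<in> carrier ?G" using z by auto
  have z_comm: "?c z \<otimes>\<^bsub>?G\<^esub> ?c q = ?c q \<otimes>\<^bsub>?G\<^esub> ?c z" if "set q \<subseteq> {1..<n}" for q
    using that z central[OF that] by (simp add: pos_class_mult pos_class_eq_iff)
  have pow: "braid_sigma n 1 [^]\<^bsub>?G\<^esub> k = ?c (replicate k 1)" for k :: nat
  proof (induction k)
    case 0
    then show ?case by (simp add: braid_group_one pos_word_def)
  next
    case (Suc k)
    have "braid_sigma n 1 = ?c [1]" by (simp add: braid_sigma_def pos_word_def)
    moreover have "set (replicate k 1) \<subseteq> {1..<n}" using n by auto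
    ultimately show ?case
      using Suc n by (simp add: pos_class_mult replicate_append_same)
  qed
  \<comment> \<open>Stated for every \<open>k\<close> because it is used twice: at \<open>m\<close>
    to enter the positive monoid, at 1 to return.\<close>
  have commute_iff: "x \<otimes>\<^bsub>?G\<^esub> braid_sigma n 1 [^]\<^bsub>?G\<^esub> k = braid_sigma n 1 [^]\<^bsub>?G\<^esub> k \<otimes>\<^bsub>?G\<^esub> x
      \<longleftrightarrow> of_word p * gen 1 ^ k = gen 1 ^ k * of_word p" for k :: nat
  proof -
    let ?r = "replicate k 1"
    have r: "set ?r \<subseteq> {1..<n}" using n by auto
    then have rc: "?c ?r \<in> carrier ?G" by auto
    have of_r: "of_word ?r = gen 1 ^ k"
      by (induction k) (simp_all add: of_word_Cons)
    have "x \<otimes>\<^bsub>?G\<^esub> ?c ?r = ?c ?r \<otimes>\<^bsub>?G\<^esub> x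
        \<longleftrightarrow> ?c z \<otimes>\<^bsub>?G\<^esub> (x \<otimes>\<^bsub>?G\<^esub> ?c ?r) = ?c z \<otimes>\<^bsub>?G\<^esub> (?c ?r \<otimes>\<^bsub>?G\<^esub> x)"
      using x rc zc by simp
    also have "?c z \<otimes>\<^bsub>?G\<^esub> (x \<otimes>\<^bsub>?G\<^esub> ?c ?r) = ?c p \<otimes>\<^bsub>?G\<^esub> ?c ?r"
      using x rc zc zx by (simp flip: m_assoc)
    also have "?c z \<otimes>\<^bsub>?G\<^esub> (?c ?r \<otimes>\<^bsub>?G\<^esub> x) = ?c ?r \<otimes>\<^bsub>?G\<^esub> ?c p"
      using x rc zc by (metis m_assoc z_comm[OF r] zx)
    also have "?c p \<otimes>\<^bsub>?G\<^esub> ?c ?r = ?c ?r \<otimes>\<^bsub>?G\<^esub> ?c p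
        \<longleftrightarrow> of_word p * gen 1 ^ k = gen 1 ^ k * of_word p"
      using p r of_r by (simp add: pos_class_mult pos_class_eq_iff of_word_append)
    finally show ?thesis unfolding pow .
  qed
  have "of_word p * gen 1 = gen 1 * of_word p"
    using gen_power_conjugation[OF m] comm commute_iff by blast
  moreover have "braid_sigma n 1 \<in> carrier ?G"
    using n by (simp add: braid_sigma_def)
  ultimately show ?thesis
    using commute_iff[of 1] by simp
qed

theorem theorem2p11:
  fixes n m :: nat and H1 H2 :: "bword set"
  assumes "n \<ge> 2" and "m \<ge> 1"
    and "half_twist n H1" and "half_twist n H2"
    and "H1 [^]\<^bsub>braid_group n\<^esub> m = H2 [^]\<^bsub>braid_group n\<^esub> m"
  shows "H1 = H2"
proof -
  interpret group "braid_group n" by (rule group_braid_group)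
  let ?G = "braid_group n" and ?s = "braid_sigma n 1"
  have s: "?s \<in> carrier ?G"
    using assms(1) by (simp add: braid_sigma_def)
  obtain p where p: "p \<in> carrier ?G" and H1: "H1 = inv\<^bsub>?G\<^esub> p \<otimes>\<^bsub>?G\<^esub> ?s \<otimes>\<^bsub>?G\<^esub> p"
    using assms(3) by (auto simp: half_twist_def)
  obtain q where q: "q \<in> carrier ?G" and H2: "H2 = inv\<^bsub>?G\<^esub> q \<otimes>\<^bsub>?G\<^esub> ?s \<otimes>\<^bsub>?G\<^esub> q"
    using assms(4) by (auto simp: half_twist_def)
  \<comment> \<open>Two conjugates of \<open>a\<close> agree exactly when \<open>p\<close> times the
    inverse of \<open>q\<close> centralizes \<open>a\<close>. This is read with the power of
    \<open>?s\<close> for the hypothesis and with \<open>?s\<close> itself for the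
    conclusion.\<close>
  have conj_eq_iff: "inv\<^bsub>?G\<^esub> p \<otimes>\<^bsub>?G\<^esub> a \<otimes>\<^bsub>?G\<^esub> p = inv\<^bsub>?G\<^esub> q \<otimes>\<^bsub>?G\<^esub> a \<otimes>\<^bsub>?G\<^esub> q
      \<longleftrightarrow> (p \<otimes>\<^bsub>?G\<^esub> inv\<^bsub>?G\<^esub> q) \<otimes>\<^bsub>?G\<^esub> a = a \<otimes>\<^bsub>?G\<^esub> (p \<otimes>\<^bsub>?G\<^esub> inv\<^bsub>?G\<^esub> q)"
    if a: "a \<in> carrier ?G" for a
  proof -
    have "inv\<^bsub>?G\<^esub> p \<otimes>\<^bsub>?G\<^esub> a \<otimes>\<^bsub>?G\<^esub> p = inv\<^bsub>?G\<^esub> q \<otimes>\<^bsub>?G\<^esub> a \<otimes>\<^bsub>?G\<^esub> q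
      \<longleftrightarrow> p \<otimes>\<^bsub>?G\<^esub> (inv\<^bsub>?G\<^esub> p \<otimes>\<^bsub>?G\<^esub> a \<otimes>\<^bsub>?G\<^esub> p) \<otimes>\<^bsub>?G\<^esub> inv\<^bsub>?G\<^esub> q
        = p \<otimes>\<^bsub>?G\<^esub> (inv\<^bsub>?G\<^esub> q \<otimes>\<^bsub>?G\<^esub> a \<otimes>\<^bsub>?G\<^esub> q) \<otimes>\<^bsub>?G\<^esub> inv\<^bsub>?G\<^esub> q"
      using a p q by simp
    also have "p \<otimes>\<^bsub>?G\<^esub> (inv\<^bsub>?G\<^esub> p \<otimes>\<^bsub>?G\<^esub> a \<otimes>\<^bsub>?G\<^esub> p) \<otimes>\<^bsub>?G\<^esub> inv\<^bsub>?G\<^esub> q = a \<otimes>\<^bsub>?G\<^esub> (p \<otimes>\<^bsub>?G\<^esub> inv\<^bsub>?G\<^esub> q)"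
    proof -
      have "p \<otimes>\<^bsub>?G\<^esub> (inv\<^bsub>?G\<^esub> p \<otimes>\<^bsub>?G\<^esub> a \<otimes>\<^bsub>?G\<^esub> p) = (p \<otimes>\<^bsub>?G\<^esub> inv\<^bsub>?G\<^esub> p) \<otimes>\<^bsub>?G\<^esub> a \<otimes>\<^bsub>?G\<^esub> p"
        using a p by (simp only: m_assoc m_closed inv_closed)
      then show ?thesis using a p q by (simp add: m_assoc)
    qed
    also have "p \<otimes>\<^bsub>?G\<^esub> (inv\<^bsub>?G\<^esub> q \<otimes>\<^bsub>?G\<^esub> a \<otimes>\<^bsub>?G\<^esub> q) \<otimes>\<^bsub>?G\<^esub> inv\<^bsub>?G\<^esub> q = (p \<otimes>\<^bsub>?G\<^esub> inv\<^bsub>?G\<^esub> q) \<otimes>\<^bsub>?G\<^esub> a"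
      using a p q by (simp add: m_assoc)
    finally show ?thesis by metis
  qed
  have "(p \<otimes>\<^bsub>?G\<^esub> inv\<^bsub>?G\<^esub> q) \<otimes>\<^bsub>?G\<^esub> ?s [^]\<^bsub>?G\<^esub> m = ?s [^]\<^bsub>?G\<^esub> m \<otimes>\<^bsub>?G\<^esub> (p \<otimes>\<^bsub>?G\<^esub> inv\<^bsub>?G\<^esub> q)"
    using assms(5) p q s by (simp add: H1 H2 conj_pow flip: conj_eq_iff)
  then have "(p \<otimes>\<^bsub>?G\<^esub> inv\<^bsub>?G\<^esub> q) \<otimes>\<^bsub>?G\<^esub> ?s = ?s \<otimes>\<^bsub>?G\<^esub> (p \<otimes>\<^bsub>?G\<^esub> inv\<^bsub>?G\<^esub> q)"
    using p q assms(1,2) by (intro sigma_power_centralizer) auto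
  then show ?thesis
    unfolding H1 H2 conj_eq_iff[OF s] .
qed

end
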